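(* Let $G=(V,E)$ be a simple, strongly connected and balanced directed graph on $V=\{1,\dots,n\}$ with $n\ge2$, with Laplacian $L$ and resistance matrix $R=[r_{ij}]$. Let $M=L-L'$ and let $\tau\in\mathbb{R}^n$ have entries $\tau_i=2-\sum_{\{j:(i,j)\in E\}} r_{ji}$. Then $\tau'R\tau\neq 0$, $R$ is nonsingular, and \[R^{-1}=-\frac12 L+\frac{1}{\tau'R\tau}\,\tau\big(\tau'+\mathbf{1}'\operatorname{diag}(L^\dagger)M\big).\]
   Context: For a simple directed graph $G=(V,E)$, the adjacency matrix is $A=[a_{ij}]$ with $a_{ij}=1$ if $(i,j)\in E$ and $0$ otherwise. $G$ is balanced if every vertex has indegree (column sum of $A$) equal to outdegree (row sum of $A$); strongly connected if every ordered pair of vertices is joined by a directed path. The Laplacian is $L=\operatorname{Diag}(A\mathbf{1})-A$. With $L^\dagger=[l^\dagger_{ij}]$ the Moore–Penrose inverse of $L$, the resistance is $r_{ij}=l^\dagger_{ii}+l^\dagger_{jj}-2l^\dagger_{ij}$ and $R=[r_{ij}]$. $\mathbf{1}$ is the all-ones vector, $'$ denotes transpose, and $\operatorname{diag}(Y)$ is the diagonal matrix with the diagonal entries of $Y$. *)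

theory Defs
  imports "HOL-Analysis.Analysis" "Graph_Theory.Graph_Theory"
begin

definition Diag :: "real ^ 'n \<Rightarrow> real ^ 'n ^ 'n" where
  "Diag v = (\<chi> i j. if i = j then v $ i else 0)"

definition diag :: "real ^ 'n ^ 'n \<Rightarrow> real ^ 'n ^ 'n" where
  "diag Y = Diag (\<chi> i. Y $ i $ i)"

text \<open>The product \<open>u v'\<close> of a column and a row.\<close>

definition outer :: "real ^ 'n \<Rightarrow> real ^ 'n \<Rightarrow> real ^ 'n ^ 'n" where
  "outer u v = (\<chi> i j. u $ i * v $ j)"

definition is_moore_penrose :: "real ^ 'n ^ 'm \<Rightarrow> real ^ 'm ^ 'n \<Rightarrow> bool" where
  "is_moore_penrose A X \<longleftrightarrow>
     A ** X ** A = A \<and> X ** A ** X = X \<and>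
     transpose (A ** X) = A ** X \<and> transpose (X ** A) = X ** A"

lemma moore_penrose_unique:
  fixes A :: "real ^ 'n ^ 'm"
  assumes "is_moore_penrose A X" and "is_moore_penrose A Y"
  shows "X = Y"
proof -
  have X: "A ** X ** A = A" "X ** A ** X = X"
      "transpose (A ** X) = A ** X" "transpose (X ** A) = X ** A"
    and Y: "A ** Y ** A = A" "Y ** A ** Y = Y"
      "transpose (A ** Y) = A ** Y" "transpose (Y ** A) = Y ** A"
    using assms by (simp_all add: is_moore_penrose_def)
  have "A ** X = transpose (A ** Y ** (A ** X))"
    using X(3) Y(1) by (simp add: matrix_mul_assoc)
  also have "\<dots> = A ** X ** (A ** Y)"
    using X(3) Y(3) by (simp only: matrix_transpose_mul[of "A ** Y" "A ** X"])
  also have "\<dots> = A ** Y"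
    using X(1) by (simp add: matrix_mul_assoc)
  finally have 1: "A ** X = A ** Y" .
  have "X ** A = transpose (X ** (A ** Y ** A))"
    using X(4) Y(1) by simp
  also have "\<dots> = transpose (X ** A ** (Y ** A))"
    by (simp add: matrix_mul_assoc)
  also have "\<dots> = Y ** A ** (X ** A)"
    using X(4) Y(4) by (simp only: matrix_transpose_mul[of "X ** A" "Y ** A"])
  also have "\<dots> = Y ** (A ** X ** A)"
    by (simp add: matrix_mul_assoc)
  finally have 2: "X ** A = Y ** A" using X(1) by simp
  have "X = Y ** (A ** X)" using X(2) 2 by (simp add: matrix_mul_assoc)
  also have "\<dots> = Y" using Y(2) 1 by (simp add: matrix_mul_assoc)
  finally show ?thesis .
qed

lemma normal_equations_solvable:
  fixes A :: "real ^ 'n ^ 'm"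
  obtains P where "transpose A ** A ** P = transpose A"
proof -
  have "\<exists>x. transpose A *v (A *v x) = transpose A *v y" for y
  proof -
    have sub: "subspace (range ((*v) A))"
      by (intro linear_subspace_image subspace_UNIV) simp
    obtain u z where u: "u \<in> span (range ((*v) A))"
      and z: "\<And>w. w \<in> span (range ((*v) A)) \<Longrightarrow> orthogonal z w" and y: "y = u + z"
      by (rule orthogonal_subspace_decomp_exists[of "range ((*v) A)" y]) (rule that)
    from u sub obtain x where x: "u = A *v x" by (auto simp: span_eq_iff[THEN iffD2])
    have "transpose A *v z = 0"
    proof -
      have "z \<bullet> (A *v (transpose A *v z)) = 0"
        using z[of "A *v (transpose A *v z)"] by (simp add: orthogonal_def span_base)
      then have "(transpose A *v z) \<bullet> (transpose A *v z) = 0"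
        by (simp only: transpose_matrix_vector dot_lmul_matrix)
      then show ?thesis by simp
    qed
    then show ?thesis using x y by (auto simp: matrix_vector_right_distrib)
  qed
  then obtain f where f: "\<And>y. transpose A *v (A *v f y) = transpose A *v y" by metis
  define P where "P = (\<chi> i j. f (axis j 1) $ i)"
  have c: "M ** P = (\<chi> i j. (M *v f (axis j 1)) $ i)" for M :: "real ^ 'n ^ 'k"
    by (simp add: P_def matrix_matrix_mult_def matrix_vector_mult_def vec_eq_iff)
  have "transpose A ** A ** P = transpose A"
    unfolding c matrix_vector_mul_assoc[symmetric] f
    by (simp add: vec_eq_iff matrix_vector_mult_basis column_def)
  then show ?thesis by (rule that)
qed

lemma moore_penrose_exists:
  fixes A :: "real ^ 'n ^ 'm"
  shows "\<exists>X. is_moore_penrose A X"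
proof -
  obtain P where P: "transpose A ** A ** P = transpose A"
    by (rule normal_equations_solvable)
  obtain Q' where "transpose (transpose A) ** transpose A ** Q' = transpose (transpose A)"
    by (rule normal_equations_solvable)
  then have Q': "A ** transpose A ** Q' = A" by simp
  define Q where "Q = transpose Q'"
  have Q: "Q ** A ** transpose A = transpose A"
    using arg_cong[OF Q', of transpose] by (simp add: Q_def matrix_transpose_mul matrix_mul_assoc)
  have "transpose (A ** P) ** (A ** P) = transpose P ** (transpose A ** A ** P)"
    by (simp add: matrix_transpose_mul matrix_mul_assoc)
  then have AP': "transpose (A ** P) ** (A ** P) = transpose (A ** P)"
    by (simp add: P matrix_transpose_mul)
  have AP: "transpose (A ** P) = A ** P"
    using arg_cong[OF AP', of transpose] AP' by (simp add: matrix_transpose_mul matrix_mul_assoc)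
  have "transpose A ** (A ** P) = transpose A" using P by (simp add: matrix_mul_assoc)
  from arg_cong[OF this, of transpose] have APA: "A ** P ** A = A"
    using AP by (simp add: matrix_transpose_mul[of _ "A ** P"])
  have "(Q ** A) ** transpose (Q ** A) = (Q ** A ** transpose A) ** transpose Q"
    by (simp add: matrix_transpose_mul matrix_mul_assoc)
  then have QA': "(Q ** A) ** transpose (Q ** A) = transpose (Q ** A)"
    by (simp add: Q matrix_transpose_mul)
  have QA: "transpose (Q ** A) = Q ** A"
    using arg_cong[OF QA', of transpose] QA' by (simp add: matrix_transpose_mul matrix_mul_assoc)
  from arg_cong[OF Q, of transpose] have AQA: "A ** (Q ** A) = A"
    using QA by (simp add: matrix_transpose_mul[of "Q ** A"])
  have 1: "A ** (Q ** A ** P) = A ** P" using AQA by (simp add: matrix_mul_assoc)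
  have 2: "Q ** A ** P ** A = Q ** A" using arg_cong[OF APA, of "(**) Q"] by (simp add: matrix_mul_assoc)
  have 3: "Q ** A ** (Q ** A ** P) = Q ** A ** P" using arg_cong[OF 1, of "(**) Q"] by (simp add: matrix_mul_assoc)
  have "is_moore_penrose A (Q ** A ** P)"
    unfolding is_moore_penrose_def using 1 2 3 AP QA APA by simp
  then show ?thesis ..
qed

definition pinv :: "real ^ 'n ^ 'm \<Rightarrow> real ^ 'm ^ 'n" where
  "pinv A = (THE X. is_moore_penrose A X)"

lemma is_moore_penrose_pinv: "is_moore_penrose A (pinv A)"
  unfolding pinv_def
  using moore_penrose_exists[of A] moore_penrose_unique[of A] by (blast intro: theI)

definition balanced :: "'n pair_pre_digraph \<Rightarrow> bool" where
  "balanced G \<longleftrightarrow> (\<forall>v \<in> pverts G. in_degree G v = out_degree G v)"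

text \<open>The matrices below describe \<open>G\<close> when its vertex set is the whole index type.\<close>

definition adjacency :: "'n pair_pre_digraph \<Rightarrow> real ^ 'n ^ 'n" where
  "adjacency G = (\<chi> i j. if (i, j) \<in> parcs G then 1 else 0)"

lemma
  fixes G :: "'n::finite pair_pre_digraph"
  shows out_degree_eq_row_sum: "real (out_degree G i) = (\<Sum>j\<in>UNIV. adjacency G $ i $ j)"
    and in_degree_eq_column_sum: "real (in_degree G j) = (\<Sum>i\<in>UNIV. adjacency G $ i $ j)"
proof -
  have o: "out_arcs G i = Pair i ` {j. (i, j) \<in> parcs G}"
    and i: "in_arcs G j = (\<lambda>i. (i, j)) ` {i. (i, j) \<in> parcs G}"
    by (auto simp: out_arcs_def in_arcs_def)
  show "real (out_degree G i) = (\<Sum>j\<in>UNIV. adjacency G $ i $ j)"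
    unfolding out_degree_def o
    by (subst card_image) (auto simp: inj_on_def adjacency_def sum.If_cases)
  show "real (in_degree G j) = (\<Sum>i\<in>UNIV. adjacency G $ i $ j)"
    unfolding in_degree_def i
    by (subst card_image) (auto simp: inj_on_def adjacency_def sum.If_cases)
qed

definition laplacian :: "'n::finite pair_pre_digraph \<Rightarrow> real ^ 'n ^ 'n" where
  "laplacian G = Diag (adjacency G *v 1) - adjacency G"

definition resistance :: "'n::finite pair_pre_digraph \<Rightarrow> real ^ 'n ^ 'n" where
  "resistance G =
     (let K = pinv (laplacian G) in \<chi> i j. K $ i $ i + K $ j $ j - 2 * K $ i $ j)"

definition tau :: "'n::finite pair_pre_digraph \<Rightarrow> real ^ 'n" where
  "tau G = (\<chi> i. 2 - (\<Sum>j | (i, j) \<in> parcs G. resistance G $ j $ i))"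

end

theory Submission
  imports Defs
begin

text \<open>
  Write \<open>K = L\<^sup>\<dagger>\<close>, \<open>J = 1 1'\<close> and let \<open>d\<close> be the vector of diagonal entries of \<open>K\<close>. Balancedness
  turns the quadratic form \<open>x' L x\<close> into half the sum of \<open>(x\<^sub>i - x\<^sub>j)\<^sup>2\<close> over the arcs, so by strong
  connectivity both \<open>L\<close> and \<open>L'\<close> have the constant vectors as kernel, and
  \<open>L K = K L = I - J/n\<close>. Then \<open>R = d 1' + 1 d' - 2K\<close> and \<open>\<tau> = L d + (2/n) 1\<close>, which give
  \<open>R \<tau> = c 1\<close> with \<open>c = d' L d + (4/n) 1' d\<close> and \<open>\<tau>' R \<tau> = 2c\<close>. Here \<open>c > 0\<close> because the diagonal
  entries \<open>d\<^sub>i = (K e\<^sub>i)' L (K e\<^sub>i)\<close> are positive. Finally \<open>R L = 1 d' L - 2 (I - J/n)\<close>, and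
  \<open>\<tau>' + 1' diag(K) M = d' L + (2/n) 1'\<close>, so the claimed inverse is a right inverse of \<open>R\<close>.
\<close>

section \<open>Rank-one matrices and inverses\<close>

lemma matrix_mult_outer: "A ** outer u v = outer (A *v u) v"
  by (simp add: outer_def matrix_matrix_mult_def matrix_vector_mult_def vec_eq_iff
      sum_distrib_right mult.assoc)

lemma outer_mult_matrix: "outer u v ** A = outer u (v v* A)"
  by (simp add: outer_def matrix_matrix_mult_def vector_matrix_mult_def vec_eq_iff
      sum_distrib_left mult_ac)

lemma outer_mult_vector: "outer u v *v x = (v \<bullet> x) *\<^sub>R u"
  by (simp add: outer_def matrix_vector_mult_def vec_eq_iff inner_vec_def
      sum_distrib_right sum_distrib_left mult_ac)

lemma matrix_add_rdistrib:
  fixes A :: "'a::semiring_1 ^ 'n ^ 'm"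
  shows "(A + B) ** C = A ** C + B ** C"
  by (simp add: matrix_matrix_mult_def vec_eq_iff distrib_right sum.distrib)

lemma matrix_diff_ldistrib:
  fixes A :: "'a::ring_1 ^ 'n ^ 'm"
  shows "A ** (B - C) = A ** B - A ** C"
  by (simp add: matrix_matrix_mult_def vec_eq_iff right_diff_distrib sum_subtractf)

lemma matrix_diff_rdistrib:
  fixes A :: "'a::ring_1 ^ 'n ^ 'm"
  shows "(A - B) ** C = A ** C - B ** C"
  by (simp add: matrix_matrix_mult_def vec_eq_iff left_diff_distrib sum_subtractf)

lemma matrix_inv_eqI:
  fixes A B :: "real ^ 'n ^ 'n"
  assumes "A ** B = mat 1"
  shows "invertible A" "matrix_inv A = B"
proof -
  have BA: "B ** A = mat 1"
    using assms by (simp add: matrix_left_right_inverse)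
  then show "invertible A"
    using assms by (auto simp: invertible_def)
  \<comment> \<open>\<open>matrix_inv\<close> is a Hilbert choice, so its left-inverse property is
    extracted first; multiplying \<open>A ** B\<close> by it then identifies it with
    \<open>B\<close>.\<close>
  then have "matrix_inv A ** A = mat 1"
    unfolding invertible_def matrix_inv_def by (rule someI2_ex) simp
  then have "matrix_inv A ** (A ** B) = B"
    by (simp add: matrix_mul_assoc)
  then show "matrix_inv A = B"
    using assms by simp
qed

section \<open>Pseudoinverses of matrices with constant kernel vectors\<close>

lemma matrix_columns_constant:
  fixes A :: "real ^ 'n ^ 'n"
  assumes kernel: "\<And>x i j. A *v x = 0 \<Longrightarrow> x $ i = x $ j" and "A ** B = 0"
  shows "B $ i $ k = B $ j $ k"
proof -
  have "A *v column k B = column k (A ** B)"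
    by (simp add: column_def matrix_vector_mult_def matrix_matrix_mult_def vec_eq_iff)
  also have "\<dots> = 0"
    using assms(2) by (simp add: column_def vec_eq_iff)
  finally show ?thesis
    using kernel[of "column k B" i j] by (simp add: column_def)
qed

text \<open>The complement \<open>Q = mat 1 - P\<close> satisfies \<open>A ** Q = 0\<close>, so its
  columns are constant; symmetry makes it a multiple of the all-ones matrix, and
  \<open>P *v 1 = 0\<close> fixes its row sums at 1. This serves for both Penrose
  projections.\<close>

lemma symmetric_projection_eq:
  fixes A P :: "real ^ 'n ^ 'n"
  assumes kernel: "\<And>x i j. A *v x = 0 \<Longrightarrow> x $ i = x $ j"
    and "A ** P = A" and sym: "transpose P = P" and P1: "P *v 1 = 0"
  shows "P = mat 1 - (1 / CARD('n)) *\<^sub>R outer 1 1"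
proof -
  define Q where "Q = mat 1 - P"
  have "A ** Q = 0"
    using assms(2) by (simp add: Q_def matrix_diff_ldistrib)
  then have col: "Q $ i $ k = Q $ j $ k" for i j k
    by (intro matrix_columns_constant[of A Q] kernel)
  have "transpose Q = Q"
    using sym by (simp add: Q_def transpose_def vec_eq_iff mat_def)
  then have "Q $ i $ j = Q $ j $ i" for i j
    by (simp add: transpose_def vec_eq_iff)
  with col have const: "Q $ i $ j = Q $ k $ l" for i j k l
    by metis
  have "Q *v 1 = 1"
    using P1 by (simp add: Q_def matrix_vector_mult_diff_rdistrib)
  then have "(\<Sum>j\<in>UNIV. Q $ i $ j) = 1" for i
    by (simp add: matrix_vector_mult_def vec_eq_iff)
  moreover have "(\<Sum>j\<in>UNIV. Q $ i $ j) = real CARD('n) * Q $ i $ k" for i k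
    by (subst sum.cong[OF refl const[of i _ i k]]) simp_all
  ultimately have "Q $ i $ k = 1 / CARD('n)" for i k
    by (simp add: field_simps)
  then have "Q = (1 / CARD('n)) *\<^sub>R outer 1 1"
    by (simp add: outer_def vec_eq_iff)
  then show ?thesis
    by (simp add: Q_def algebra_simps)
qed

lemma pinv_constant_kernel:
  fixes A :: "real ^ 'n ^ 'n"
  assumes "\<And>x i j. A *v x = 0 \<Longrightarrow> x $ i = x $ j"
    and "\<And>x i j. transpose A *v x = 0 \<Longrightarrow> x $ i = x $ j"
    and "A *v 1 = 0" and "1 v* A = 0"
  shows "A ** pinv A = mat 1 - (1 / CARD('n)) *\<^sub>R outer 1 1"
    and "pinv A ** A = mat 1 - (1 / CARD('n)) *\<^sub>R outer 1 1"
    and "pinv A *v 1 = 0" and "1 v* pinv A = 0"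
proof -
  let ?K = "pinv A"
  have mp: "A ** ?K ** A = A" "?K ** A ** ?K = ?K"
      "transpose (A ** ?K) = A ** ?K" "transpose (?K ** A) = ?K ** A"
    using is_moore_penrose_pinv[of A] by (simp_all add: is_moore_penrose_def)
  have "A ** (?K ** A) = A"
    using mp(1) by (simp add: matrix_mul_assoc)
  moreover have KA1: "(?K ** A) *v 1 = 0"
    using assms(3) by (simp flip: matrix_vector_mul_assoc)
  ultimately show "?K ** A = mat 1 - (1 / CARD('n)) *\<^sub>R outer 1 1"
    using assms(1) mp(4) by (intro symmetric_projection_eq[of A])
  \<comment> \<open>\<open>A ** ?K\<close> fixes \<open>A\<close> from the left only, so the
    projection lemma is applied to \<open>transpose A\<close>.\<close>
  have "transpose A ** (A ** ?K) = transpose (A ** ?K ** A)"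
    using mp(3) by (simp only: matrix_transpose_mul)
  then have "transpose A ** (A ** ?K) = transpose A"
    using mp(1) by simp
  moreover have AK1: "(A ** ?K) *v 1 = 0"
  proof -
    have "(A ** ?K) *v 1 = transpose (A ** ?K) *v 1"
      using mp(3) by simp
    also have "\<dots> = 1 v* A v* ?K"
      by (simp add: transpose_matrix_vector vector_matrix_mul_assoc)
    finally show ?thesis
      using assms(4) by simp
  qed
  ultimately show "A ** ?K = mat 1 - (1 / CARD('n)) *\<^sub>R outer 1 1"
    using assms(2) mp(3) by (intro symmetric_projection_eq[of "transpose A"])
  \<comment> \<open>The identity \<open>?K ** A ** ?K = ?K\<close> carries the vanishing on
    \<open>1\<close> from the projections to \<open>?K\<close> itself.\<close>
  have "?K *v ((A ** ?K) *v 1) = ?K *v 1"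
    using mp(2) by (simp add: matrix_vector_mul_assoc matrix_mul_assoc)
  then show "?K *v 1 = 0"
    using AK1 by simp
  have "1 v* (?K ** A) = 0"
    using KA1 mp(4) by (metis transpose_matrix_vector)
  then have "1 v* (?K ** A) v* ?K = 0"
    by simp
  then show "1 v* ?K = 0"
    using mp(2) by (simp add: vector_matrix_mul_assoc)
qed

section \<open>The Laplacian of a balanced digraph\<close>

lemma laplacian_mult_nth:
  "(laplacian G *v x) $ i = (\<Sum>j\<in>UNIV. adjacency G $ i $ j * (x $ i - x $ j))"
proof -
  have "(laplacian G *v x) $ i =
      (\<Sum>j\<in>UNIV. (if i = j then (\<Sum>k\<in>UNIV. adjacency G $ i $ k) * x $ j else 0)
        - adjacency G $ i $ j * x $ j)"
    unfolding laplacian_def Diag_def matrix_vector_mult_def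
    by (auto simp: algebra_simps intro!: sum.cong)
  then show ?thesis
    by (simp add: sum_subtractf sum_distrib_right right_diff_distrib)
qed

lemma laplacian_mult_one: "laplacian G *v 1 = 0"
  by (simp add: vec_eq_iff laplacian_mult_nth)

lemma balanced_adjacency_sums:
  fixes G :: "'n::finite pair_pre_digraph"
  assumes "pverts G = UNIV" "balanced G"
  shows "(\<Sum>i\<in>UNIV. adjacency G $ i $ j) = (\<Sum>i\<in>UNIV. adjacency G $ j $ i)"
  using assms by (simp add: balanced_def flip: out_degree_eq_row_sum in_degree_eq_column_sum)

lemma one_mult_laplacian:
  fixes G :: "'n::finite pair_pre_digraph"
  assumes "pverts G = UNIV" "balanced G"
  shows "1 v* laplacian G = 0"
proof -
  have "(1 v* laplacian G) $ j = (\<Sum>i\<in>UNIV. laplacian G $ i $ j)" for j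
    by (simp add: vector_matrix_mult_def)
  also have "\<dots> j = (\<Sum>i\<in>UNIV. (if i = j then (\<Sum>k\<in>UNIV. adjacency G $ j $ k) else 0)
      - adjacency G $ i $ j)" for j
    unfolding laplacian_def Diag_def matrix_vector_mult_def
    by (auto intro!: sum.cong)
  also have "\<dots> j = 0" for j
    by (simp add: sum_subtractf balanced_adjacency_sums[OF assms])
  finally show ?thesis
    by (simp add: vec_eq_iff)
qed

lemma laplacian_quadratic_form:
  fixes G :: "'n::finite pair_pre_digraph"
  assumes "pverts G = UNIV" "balanced G"
  shows "x \<bullet> (laplacian G *v x) =
    (\<Sum>i\<in>UNIV. \<Sum>j\<in>UNIV. adjacency G $ i $ j * (x $ i - x $ j)\<^sup>2) / 2"
proof -
  let ?a = "\<lambda>i j. adjacency G $ i $ j"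
  have "(\<Sum>i\<in>UNIV. \<Sum>j\<in>UNIV. ?a i j * (x $ j)\<^sup>2) = (\<Sum>j\<in>UNIV. (\<Sum>i\<in>UNIV. ?a i j) * (x $ j)\<^sup>2)"
    by (subst sum.swap) (simp add: sum_distrib_right)
  also have "\<dots> = (\<Sum>i\<in>UNIV. \<Sum>j\<in>UNIV. ?a i j * (x $ i)\<^sup>2)"
    by (simp add: balanced_adjacency_sums[OF assms] sum_distrib_right)
  finally have swap: "(\<Sum>i\<in>UNIV. \<Sum>j\<in>UNIV. ?a i j * (x $ j)\<^sup>2) =
      (\<Sum>i\<in>UNIV. \<Sum>j\<in>UNIV. ?a i j * (x $ i)\<^sup>2)" .
  \<comment> \<open>Each square is twice a term of the quadratic form plus a difference of squares;
    by \<open>swap\<close>, which is where balance enters, the differences cancel in the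
    total.\<close>
  have "(\<Sum>i\<in>UNIV. \<Sum>j\<in>UNIV. ?a i j * (x $ i - x $ j)\<^sup>2) =
      (\<Sum>i\<in>UNIV. \<Sum>j\<in>UNIV. 2 * (x $ i * (?a i j * (x $ i - x $ j)))
        + (?a i j * (x $ j)\<^sup>2 - ?a i j * (x $ i)\<^sup>2))"
    by (intro sum.cong refl) (simp add: power2_eq_square algebra_simps)
  also have "\<dots> = 2 * (x \<bullet> (laplacian G *v x))"
    by (simp add: sum.distrib sum_subtractf swap inner_vec_def laplacian_mult_nth
        flip: sum_distrib_left)
  finally show ?thesis by simp
qed

lemma laplacian_quadratic_form_nonneg:
  fixes G :: "'n::finite pair_pre_digraph"
  assumes "pverts G = UNIV" "balanced G"
  shows "0 \<le> x \<bullet> (laplacian G *v x)"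
  unfolding laplacian_quadratic_form[OF assms]
  by (auto intro!: sum_nonneg simp: adjacency_def)

text \<open>All terms of the sum of squares are nonnegative, so each vanishes: \<open>x\<close>
  agrees at the ends of every arc, hence along every directed path.\<close>

lemma laplacian_quadratic_form_eq_0:
  fixes G :: "'n::finite pair_pre_digraph"
  assumes V: "pverts G = UNIV" and "balanced G" "strongly_connected G"
    and zero: "x \<bullet> (laplacian G *v x) = 0"
  shows "x $ i = x $ j"
proof -
  have "(\<Sum>i\<in>UNIV. \<Sum>j\<in>UNIV. adjacency G $ i $ j * (x $ i - x $ j)\<^sup>2) = 0"
    using zero unfolding laplacian_quadratic_form[OF assms(1,2)] by simp
  moreover have "0 \<le> adjacency G $ u $ v * (x $ u - x $ v)\<^sup>2" for u v
    by (simp add: adjacency_def)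
  ultimately have "adjacency G $ u $ v * (x $ u - x $ v)\<^sup>2 = 0" for u v
    by (simp add: sum_nonneg_eq_0_iff sum_nonneg)
  then have arc: "x $ u = x $ v" if "(u, v) \<in> parcs G" for u v
    using that by (force simp: adjacency_def)
  have "i \<rightarrow>\<^sup>*\<^bsub>G\<^esub> j"
    using assms(3) V by (auto simp: strongly_connected_def)
  then have "(i, j) \<in> (arcs_ends G)\<^sup>*"
    by (rule reachable_rtranclI)
  then show ?thesis
    by (induction rule: rtrancl_induct) (auto dest: arc simp: arcs_ends_conv)
qed

section \<open>The resistance matrix and its inverse\<close>

lemma balanced_resistance_inverse:
  fixes G :: "'n::finite pair_pre_digraph"
    and L K R :: "real ^ 'n ^ 'n" and d \<tau> :: "real ^ 'n"
  assumes n: "CARD('n) \<ge> 2"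
    and G: "pverts G = UNIV" "balanced G" "strongly_connected G"
  defines "L \<equiv> laplacian G" and "K \<equiv> pinv L" and "R \<equiv> resistance G"
    and "\<tau> \<equiv> tau G" and "d \<equiv> \<chi> i. K $ i $ i"
  shows "\<tau> \<bullet> (R *v \<tau>) > 0"
    and "R ** (- (1/2) *\<^sub>R L + (1 / (\<tau> \<bullet> (R *v \<tau>))) *\<^sub>R outer \<tau> (\<tau> + d v* (L - transpose L))) = mat 1"
proof -
  define N where "N = real CARD('n)"
  have N: "N \<ge> 2" using n by (simp add: N_def)
  have L1: "L *v 1 = 0" and oneL: "1 v* L = 0"
    unfolding L_def using laplacian_mult_one one_mult_laplacian[OF G(1,2)] by auto
  have ker: "x $ i = x $ j" if "L *v x = 0" for x i j
    using that laplacian_quadratic_form_eq_0[OF G] by (simp add: L_def)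
  have kerT: "x $ i = x $ j" if "transpose L *v x = 0" for x i j
  proof -
    have "x \<bullet> (L *v x) = (transpose L *v x) \<bullet> x"
      by (simp add: transpose_matrix_vector dot_lmul_matrix)
    then show ?thesis
      using that laplacian_quadratic_form_eq_0[OF G] by (simp add: L_def)
  qed
  have LK: "L ** K = mat 1 - (1/N) *\<^sub>R outer 1 1" and KL: "K ** L = mat 1 - (1/N) *\<^sub>R outer 1 1"
    and K1: "K *v 1 = 0" and oneK: "1 v* K = 0"
    using pinv_constant_kernel[of L, OF ker kerT L1 oneL] by (simp_all add: K_def N_def)
  have R: "R = outer d 1 + outer 1 d - 2 *\<^sub>R K"
    by (simp add: R_def resistance_def d_def K_def L_def outer_def vec_eq_iff Let_def)
  have d_pos: "d $ i > 0" for i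
  proof -
    let ?y = "K *v axis i 1"
    have Ly: "L *v ?y = axis i 1 - (1/N) *\<^sub>R 1"
      by (simp add: matrix_vector_mul_assoc LK matrix_vector_mult_diff_rdistrib
          scaleR_matrix_vector_assoc[symmetric] outer_mult_vector inner_axis)
    have "?y \<bullet> 1 = 0"
      by (metis dot_lmul_matrix oneK inner_zero_left inner_commute)
    then have "?y \<bullet> (L *v ?y) = ?y $ i"
      unfolding Ly by (simp add: inner_diff_right inner_axis)
    also have "?y $ i = d $ i"
      by (simp add: d_def matrix_vector_mult_basis column_def)
    finally have eq: "?y \<bullet> (L *v ?y) = d $ i" .
    \<comment> \<open>Otherwise \<open>?y\<close> would be constant and \<open>L *v ?y\<close> zero,
      while its entry at \<open>i\<close> is 1 - 1/N, nonzero since N \<ge> 2.\<close>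
    have "d $ i \<noteq> 0"
    proof
      assume "d $ i = 0"
      with eq have "?y \<bullet> (laplacian G *v ?y) = 0"
        by (simp add: L_def)
      from laplacian_quadratic_form_eq_0[OF G this] have const: "?y $ i - ?y $ j = 0" for j
        by (metis diff_self)
      have "(L *v ?y) $ i = 0"
        unfolding L_def laplacian_mult_nth const by simp
      then show False
        using N unfolding Ly by simp
    qed
    moreover have "d $ i \<ge> 0"
      using laplacian_quadratic_form_nonneg[OF G(1,2)] eq by (metis L_def)
    ultimately show ?thesis by simp
  qed
  have tau: "\<tau> = L *v d + (2/N) *\<^sub>R 1"
  proof -
    have "\<tau> $ i = (L *v d + (2/N) *\<^sub>R 1) $ i" for i
    proof -
      let ?a = "\<lambda>j. adjacency G $ i $ j"
      \<comment> \<open>The resistance \<open>R $ j $ i\<close> splits into twice this difference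
        minus \<open>d $ i - d $ j\<close>; weighted by the arcs, the two pieces sum to entries of
        \<open>L ** K\<close> and \<open>L *v d\<close>.\<close>
      have "(\<Sum>j\<in>UNIV. ?a j * (K $ i $ i - K $ j $ i)) = (L ** K) $ i $ i"
        using laplacian_mult_nth[of G "column i K" i]
        by (simp add: L_def column_def matrix_matrix_mult_def matrix_vector_mult_def)
      also have "\<dots> = 1 - 1/N"
        by (simp add: LK mat_def outer_def)
      finally have *: "(\<Sum>j\<in>UNIV. ?a j * (K $ i $ i - K $ j $ i)) = 1 - 1/N" .
      have "(\<Sum>j | (i, j) \<in> parcs G. R $ j $ i) = (\<Sum>j\<in>UNIV. ?a j * R $ j $ i)"
        by (simp add: adjacency_def if_distrib[of "\<lambda>c. c * _"] sum.If_cases cong: if_cong)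
      also have "\<dots> = (\<Sum>j\<in>UNIV. 2 * (?a j * (K $ i $ i - K $ j $ i)) - ?a j * (d $ i - d $ j))"
        by (intro sum.cong) (simp_all add: R outer_def d_def algebra_simps)
      also have "\<dots> = 2 * (1 - 1/N) - (L *v d) $ i"
        by (simp add: sum_subtractf * L_def laplacian_mult_nth flip: sum_distrib_left)
      finally show ?thesis
        by (simp add: \<tau>_def tau_def R_def)
    qed
    then show ?thesis by (simp add: vec_eq_iff)
  qed
  \<comment> \<open>In \<open>R *v \<tau>\<close> the term \<open>2 *\<^sub>R d\<close> from
    \<open>outer d 1\<close> cancels against \<open>K *v \<tau>\<close>; \<open>c\<close> collects
    the remaining multiples of \<open>1\<close>.\<close>
  define c where "c = d \<bullet> \<tau> + (2/N) * (1 \<bullet> d)"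
  have one_one: "(1 :: real ^ 'n) \<bullet> 1 = N"
    by (simp add: inner_vec_def N_def)
  have one_L: "1 \<bullet> (L *v x) = 0" for x
    by (metis dot_lmul_matrix oneL inner_zero_left)
  have one_tau: "1 \<bullet> \<tau> = 2"
    using N by (simp add: tau inner_add_right one_L one_one)
  have K_tau: "K *v \<tau> = d - ((1 \<bullet> d)/N) *\<^sub>R 1"
    by (simp add: tau matrix_vector_right_distrib matrix_vector_mul_assoc KL K1
        matrix_vector_mult_diff_rdistrib scaleR_matrix_vector_assoc[symmetric]
        matrix_vector_mult_scaleR outer_mult_vector)
  have R_tau: "R *v \<tau> = c *\<^sub>R 1"
    by (simp add: R K_tau matrix_vector_mult_diff_rdistrib matrix_vector_mult_add_rdistrib
        scaleR_matrix_vector_assoc[symmetric] outer_mult_vector one_tau c_def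
        vec_eq_iff algebra_simps)
  then have tRt: "\<tau> \<bullet> (R *v \<tau>) = 2 * c"
    using one_tau by (simp add: inner_commute)
  have one_d: "1 \<bullet> d > 0"
    using d_pos by (simp add: inner_vec_def sum_pos)
  have "c = d \<bullet> (L *v d) + (4/N) * (1 \<bullet> d)"
    by (simp add: c_def tau inner_add_right inner_commute)
  moreover have "d \<bullet> (L *v d) \<ge> 0"
    using laplacian_quadratic_form_nonneg[OF G(1,2)] by (simp add: L_def)
  moreover have "(4/N) * (1 \<bullet> d) > 0"
    using one_d N by simp
  ultimately have c: "c > 0" by linarith
  then show "\<tau> \<bullet> (R *v \<tau>) > 0"
    by (simp add: tRt)
  \<comment> \<open>\<open>d v* transpose L\<close> is \<open>L *v d\<close>, which cancels the
    first summand of \<open>\<tau>\<close>.\<close>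
  have row: "\<tau> + d v* (L - transpose L) = d v* L + (2/N) *\<^sub>R 1"
    by (simp add: tau vector_matrix_mult_def matrix_vector_mult_def transpose_def vec_eq_iff
        algebra_simps sum_subtractf)
  have R_L: "R ** L = outer 1 (d v* L) - 2 *\<^sub>R (mat 1 - (1/N) *\<^sub>R outer 1 1)"
  proof -
    have "outer d 1 ** L = 0"
      by (simp add: outer_mult_matrix oneL) (simp add: outer_def vec_eq_iff)
    then show ?thesis
      by (simp add: R KL[symmetric] outer_mult_matrix matrix_diff_rdistrib matrix_add_rdistrib
          scalar_matrix_assoc[symmetric])
  qed
  have R_outer: "R ** outer \<tau> (\<tau> + d v* (L - transpose L)) =
      c *\<^sub>R outer 1 (d v* L) + (2 * c / N) *\<^sub>R outer 1 1"
    unfolding matrix_mult_outer R_tau row by (simp add: outer_def vec_eq_iff algebra_simps)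
  show "R ** (- (1/2) *\<^sub>R L
      + (1 / (\<tau> \<bullet> (R *v \<tau>))) *\<^sub>R outer \<tau> (\<tau> + d v* (L - transpose L))) = mat 1"
    \<comment> \<open>With the factor 1/(2c), \<open>R_outer\<close> contributes half of
      \<open>outer 1 (d v* L)\<close> plus 1/N times \<open>outer 1 1\<close>, exactly cancelling
      what -1/2 times \<open>R_L\<close> leaves beside \<open>mat 1\<close>.\<close>
    unfolding matrix_add_ldistrib matrix_scalar_ac scalar_matrix_assoc[symmetric] tRt R_L R_outer
    using c by (simp add: vec_eq_iff field_simps)
qed

theorem theorem4p2:
  fixes G :: "'n::finite pair_pre_digraph"
    and L R M :: "real ^ 'n ^ 'n" and \<tau> :: "real ^ 'n"
  assumes "CARD('n) \<ge> 2"
    and "pair_digraph G" and "pverts G = UNIV"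
    and "strongly_connected G" and "balanced G"
  defines "L \<equiv> laplacian G" and "R \<equiv> resistance G"
    and "M \<equiv> L - transpose L" and "\<tau> \<equiv> tau G"
  shows "\<tau> \<bullet> (R *v \<tau>) \<noteq> 0 \<and> invertible R \<and>
    matrix_inv R = - (1/2) *\<^sub>R L +
      (1 / (\<tau> \<bullet> (R *v \<tau>))) *\<^sub>R outer \<tau> (\<tau> + 1 v* (diag (pinv L) ** M))"
proof -
  have "1 v* diag (pinv L) = (\<chi> i. pinv L $ i $ i)"
    by (simp add: diag_def Diag_def vector_matrix_mult_def vec_eq_iff)
  then have row: "1 v* (diag (pinv L) ** M) = (\<chi> i. pinv L $ i $ i) v* M"
    by (simp flip: vector_matrix_mul_assoc)
  note inverse = balanced_resistance_inverse[OF assms(1,3,5,4), folded L_def R_def \<tau>_def,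
      folded M_def, folded row]
  show ?thesis
    using inverse(1) matrix_inv_eqI[OF inverse(2)] by simp
qed

end
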